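(* Let $b>1$ be a real number and let $y=(y_n)_{n\ge 1}$ be an arbitrary sequence of real numbers in $[0,1]$. Set \[ E(b,y):=\{x>1:\ \|x^n-y_n\|<b^{-n}\ \text{for infinitely many } n\}. \] Then for every real $v>1$, \[ \lim_{\epsilon\to 0}\dim_H\big([v-\epsilon,v+\epsilon]\cap E(b,y)\big)=\frac{\log v}{\log (bv)}. \]
   Context: $\|t\|$ denotes the distance from a real number $t$ to the nearest integer, and $\dim_H$ denotes Hausdorff dimension. *)

theory Defs
  imports "HOL-Analysis.Analysis"
begin

text \<open>Hausdorff measure and dimension of subsets of a metric space. The convention at exponent
  \<open>0\<close> is \<open>|U|\<^sup>0 = 1\<close> for nonempty \<open>U\<close> and \<open>0\<close> for the empty set, so that the \<open>0\<close>-dimensional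
  measure is the counting measure; it has to be spelled out because \<open>0 powr 0 = 0\<close> in HOL.\<close>

definition diam_powr :: "'a::metric_space set \<Rightarrow> real \<Rightarrow> ennreal" where
  "diam_powr U s = (if U = {} then 0 else if s = 0 then 1 else ennreal (diameter U powr s))"

text \<open>Boundedness is required explicitly since \<open>diameter\<close> is meaningless on unbounded sets. Finite
  covers are included, as the members of a cover may be empty.\<close>

definition delta_cover :: "real \<Rightarrow> 'a::metric_space set \<Rightarrow> (nat \<Rightarrow> 'a set) \<Rightarrow> bool" where
  "delta_cover \<delta> A U \<longleftrightarrow> A \<subseteq> (\<Union>i. U i) \<and> (\<forall>i. bounded (U i) \<and> diameter (U i) \<le> \<delta>)"

definition hausdorff_premeasure :: "real \<Rightarrow> real \<Rightarrow> 'a::metric_space set \<Rightarrow> ennreal" where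
  "hausdorff_premeasure s \<delta> A = (INF U\<in>{U. delta_cover \<delta> A U}. \<Sum>i. diam_powr (U i) s)"

definition hausdorff_measure :: "real \<Rightarrow> 'a::metric_space set \<Rightarrow> ennreal" where
  "hausdorff_measure s A = (SUP \<delta>\<in>{0<..}. hausdorff_premeasure s \<delta> A)"

definition hausdorff_dim :: "'a::metric_space set \<Rightarrow> ennreal" where
  "hausdorff_dim A = (INF s\<in>{s. 0 \<le> s \<and> hausdorff_measure s A = 0}. ennreal s)"

definition nearest_int_dist :: "real \<Rightarrow> real" where
  "nearest_int_dist t = infdist t \<int>"

definition E_set :: "real \<Rightarrow> (nat \<Rightarrow> real) \<Rightarrow> real set" where
  "E_set b y = {x. x > 1 \<and> infinite {n. n \<ge> 1 \<and> nearest_int_dist (x ^ n - y n) < 1 / b ^ n}}"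

end

(*
  The upper bound covers the set, for n large, by the sets |x^n - y_n - k| < b^{-n}: near v there
  are about v^n of them, of diameter about (b v)^{-n}.

  For the lower bound, take s with (b c)^s < v < c. For every n, let \<phi>_n be a monotone self-map of
  [v, c] that is within about v^{-n} of the identity and locally constant wherever x^n - y_n is not
  close to an integer: x^n is sent through a steep staircase and pulled back by the n-th root.
  For a rapidly growing sequence n_1 < n_2 < ... the compositions \<phi>_{n_1} o ... o \<phi>_{n_k} stay
  uniformly s-Hoelder and converge to a map f. A point lying outside one of the sets attached to n_k
  has its image in a finite set depending only on k. So up to countably many values f maps
  E(b,y) \<inter> [v, c] onto an interval, and since f is s-Hoelder, E(b,y) \<inter> [v, c] has positive
  s-dimensional Hausdorff measure.
*)

theory Submission
  imports Defs
begin

section \<open>Bounds for Hausdorff measure and dimension\<close>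

lemma hausdorff_premeasure_mono:
  assumes "A \<subseteq> B"
  shows "hausdorff_premeasure s \<delta> A \<le> hausdorff_premeasure s \<delta> B"
  unfolding hausdorff_premeasure_def
  using assms by (intro INF_superset_mono order_refl) (unfold delta_cover_def, blast)

lemma hausdorff_dim_le:
  assumes "0 \<le> s" "hausdorff_measure s A = 0"
  shows "hausdorff_dim A \<le> ennreal s"
  unfolding hausdorff_dim_def using assms by (auto intro: INF_lower)

text \<open>Lebesgue measure of the image serves as the mass. A set of diameter d is mapped into an
  interval of length 2 C d^s, and for d at most 1 and t < s this is at most 2 C d^t. Hence every
  cover at scale 1 has t-sum at least (q - p) / (2 C), and the t-dimensional measure cannot
  vanish.\<close>

lemma hausdorff_dim_ge_holder_image:
  fixes f :: "'a::metric_space \<Rightarrow> real"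
  assumes "0 < s" "0 < C" "p < q" "countable N"
    and holder: "\<And>x z. x \<in> A \<Longrightarrow> z \<in> A \<Longrightarrow> \<bar>f x - f z\<bar> \<le> C * dist x z powr s"
    and image: "{p..q} - N \<subseteq> f ` A"
  shows "ennreal s \<le> hausdorff_dim A"
  unfolding hausdorff_dim_def
proof (rule INF_greatest, rule ccontr)
  fix t assume t: "t \<in> {s. 0 \<le> s \<and> hausdorff_measure s A = 0}" and nle: "\<not> ennreal s \<le> ennreal t"
  have "t < s" using nle assms(1) ennreal_leI linorder_not_le by blast
  have "hausdorff_premeasure t 1 A \<le> hausdorff_measure t A"
    unfolding hausdorff_measure_def by (rule SUP_upper) simp
  hence zero: "hausdorff_premeasure t 1 A = 0" using t by simp
  have "ennreal ((q - p) / (2 * C)) \<le> hausdorff_premeasure t 1 A"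
    unfolding hausdorff_premeasure_def
  proof (rule INF_greatest)
    fix U :: "nat \<Rightarrow> 'a set" assume "U \<in> {U. delta_cover 1 A U}"
    hence cov: "A \<subseteq> (\<Union>i. U i)" and bd: "\<And>i. bounded (U i)" and dm: "\<And>i. diameter (U i) \<le> 1"
      by (auto simp: delta_cover_def)
    define r where "r i = C * diameter (U i) powr s" for i
    \<comment> \<open>A ball around one arbitrary image point replaces the image of
      \<open>U i\<close>, which need not be measurable.\<close>
    define V where "V i = (if A \<inter> U i = {} then {} else cball (f (SOME x. x \<in> A \<inter> U i)) (r i))" for i
    have r0: "0 \<le> r i" for i using assms(2) by (simp add: r_def)
    have fV: "f x \<in> V i" if "x \<in> A" "x \<in> U i" for x i
    proof -
      define x0 where "x0 = (SOME x. x \<in> A \<inter> U i)"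
      have x0: "x0 \<in> A \<inter> U i" unfolding x0_def by (rule someI[of _ x]) (use that in auto)
      have "\<bar>f x0 - f x\<bar> \<le> C * dist x0 x powr s" using x0 that by (intro holder) auto
      also have "\<dots> \<le> r i" unfolding r_def
        using x0 that bd[of i] assms(1,2)
        by (intro mult_left_mono powr_mono2 diameter_bounded_bound) auto
      finally show ?thesis using that by (auto simp: V_def x0_def dist_real_def)
    qed
    have Vm: "emeasure lborel (V i) \<le> ennreal (2 * C) * diam_powr (U i) t" for i
    proof (cases "A \<inter> U i = {}")
      case False
      \<comment> \<open>For t = 0 the weight of a nonempty set is 1 while \<open>0 powr 0\<close> is
        0, so this exponent is compared separately.\<close>
      have "diameter (U i) powr s \<le> (if t = 0 then 1 else diameter (U i) powr t)"
        using dm[of i] diameter_ge_0[OF bd[of i]] \<open>t < s\<close> assms(1) t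
        by (auto intro: powr_le1 powr_mono')
      hence "ennreal (diameter (U i) powr s) \<le> diam_powr (U i) t"
        using False by (auto simp: diam_powr_def intro!: ennreal_leI)
      hence "ennreal (2 * C) * ennreal (diameter (U i) powr s) \<le> ennreal (2 * C) * diam_powr (U i) t"
        by (rule mult_left_mono) simp
      moreover have "emeasure lborel (V i) = ennreal (2 * r i)"
        using False r0[of i] by (simp add: V_def cball_eq_atLeastAtMost)
      ultimately show ?thesis using assms(2) by (simp add: r_def ennreal_mult'' mult.assoc)
    qed (simp add: V_def)
    have "ennreal (q - p) = emeasure lborel {p..q}" using assms(3) by simp
    also have "\<dots> = emeasure lborel ({p..q} - N)"
      using countable_imp_null_set_lborel[OF assms(4)]
      by (intro emeasure_Diff_null_set[symmetric]) auto
    also have "\<dots> \<le> emeasure lborel (\<Union>i. V i)"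
    proof (rule emeasure_mono)
      show "{p..q} - N \<subseteq> (\<Union>i. V i)"
      proof
        fix w assume "w \<in> {p..q} - N"
        then obtain x where x: "x \<in> A" "w = f x" using image by blast
        then obtain i where "x \<in> U i" using cov by blast
        thus "w \<in> (\<Union>i. V i)" using fV x by blast
      qed
      have "V i \<in> sets lborel" for i by (simp add: V_def)
      thus "(\<Union>i. V i) \<in> sets lborel" by blast
    qed
    also have "\<dots> \<le> (\<Sum>i. emeasure lborel (V i))"
      by (rule emeasure_subadditive_countably) (auto simp: V_def)
    also have "\<dots> \<le> (\<Sum>i. ennreal (2 * C) * diam_powr (U i) t)"
      by (intro suminf_le Vm) auto
    finally have "ennreal (q - p) \<le> ennreal (2 * C) * (\<Sum>i. diam_powr (U i) t)" by simp
    hence "ennreal (1 / (2 * C)) * ennreal (q - p) \<le> ennreal (1 / (2 * C)) * (ennreal (2 * C) * (\<Sum>i. diam_powr (U i) t))"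
      by (intro mult_left_mono) auto
    moreover have "ennreal (1 / (2 * C)) * ennreal (2 * C) = 1"
      using assms(2) by (simp flip: ennreal_mult)
    moreover have "ennreal (1 / (2 * C)) * ennreal (q - p) = ennreal ((q - p) / (2 * C))"
      using assms(2,3) by (simp flip: ennreal_mult)
    ultimately show "ennreal ((q - p) / (2 * C)) \<le> (\<Sum>i. diam_powr (U i) t)"
      by (simp add: mult.assoc[symmetric])
  qed
  moreover have "0 < (q - p) / (2 * C)" using assms(2,3) by simp
  ultimately show False unfolding zero using assms(2,3) by auto
qed

lemma hausdorff_dim_mono:
  assumes "A \<subseteq> B"
  shows "hausdorff_dim A \<le> hausdorff_dim B"
proof -
  have "hausdorff_measure s A \<le> hausdorff_measure s B" for s
    unfolding hausdorff_measure_def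
    by (intro SUP_mono) (auto intro: hausdorff_premeasure_mono[OF assms])
  hence "hausdorff_measure s A = 0" if "hausdorff_measure s B = 0" for s
    using that by (metis le_zero_eq)
  thus ?thesis unfolding hausdorff_dim_def by (intro INF_superset_mono) auto
qed

lemma infdist_less_obtains:
  assumes "A \<noteq> {}" "infdist x A < r"
  obtains a where "a \<in> A" "dist x a < r"
  using assms by (auto simp: infdist_def cINF_less_iff)

text \<open>The convergence half of Borel-Cantelli: since each point is hit at infinitely many
  levels, the levels from \<open>N\<close> on already cover \<open>A\<close>, and their s-sum is at
  most the tail of a geometric series.\<close>

lemma hausdorff_measure_limsup_eq_0:
  fixes A :: "'a::metric_space set"
  assumes s: "0 < s" and C: "0 \<le> C" and q: "0 \<le> q" "q < 1"
    and fin: "\<And>n. finite (I n)"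
    and cov: "\<And>x. x \<in> A \<Longrightarrow> infinite {n. \<exists>k\<in>I n. x \<in> U n k}"
    and bdd: "\<And>n k. k \<in> I n \<Longrightarrow> bounded (U n k)"
    and diam: "\<And>n k. k \<in> I n \<Longrightarrow> diameter (U n k) \<le> d n"
    and d: "d \<longlonglongrightarrow> 0"
    and sum: "\<And>n. real (card (I n)) * d n powr s \<le> C * q ^ n"
  shows "hausdorff_measure s A = 0"
proof -
  have small: "hausdorff_premeasure s \<delta> A \<le> ennreal e" if "\<delta> > 0" "e > 0" for \<delta> e
  proof -
    have "(\<lambda>n. C / (1 - q) * q ^ n) \<longlonglongrightarrow> C / (1 - q) * 0"
      using q by (intro tendsto_intros LIMSEQ_power_zero) auto
    hence ev1: "\<forall>\<^sub>F n in sequentially. C / (1 - q) * q ^ n < e" using that by (intro order_tendstoD(2)) auto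
    have ev2: "\<forall>\<^sub>F n in sequentially. d n < \<delta>" using d that by (intro order_tendstoD(2)) auto
    then obtain N where N: "\<And>n. n \<ge> N \<Longrightarrow> C / (1 - q) * q ^ n < e \<and> d n < \<delta>"
      using eventually_conj[OF ev1 ev2] unfolding eventually_sequentially by blast
    \<comment> \<open>Each level is padded with empty sets, which have weight 0, so that
      \<open>prod_decode\<close> can merge all levels into a single sequence.\<close>
    define W where "W n k = (if n \<ge> N \<and> k < card (I n) then U n (from_nat_into (I n) k) else {})" for n k
    have en: "k < card (I n) \<Longrightarrow> from_nat_into (I n) k \<in> I n" for n k
      by (rule from_nat_into) (metis card.empty less_nat_zero_code)
    have "delta_cover \<delta> A (\<lambda>i. case prod_decode i of (n, k) \<Rightarrow> W n k)"
      unfolding delta_cover_def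
    proof (intro conjI subsetI allI)
      fix x assume "x \<in> A"
      then obtain n where "n \<ge> N" "\<exists>k\<in>I n. x \<in> U n k"
        using cov unfolding infinite_nat_iff_unbounded_le by blast
      then obtain k where k: "k \<in> I n" "x \<in> U n k" by blast
      have bb: "bij_betw (from_nat_into (I n)) {..<card (I n)} (I n)" by (rule bij_betw_from_nat_into_finite[OF fin])
      then obtain j where j: "j < card (I n)" "from_nat_into (I n) j = k"
        using k unfolding bij_betw_def by (metis imageE lessThan_iff)
      hence "x \<in> W n j" using k \<open>n \<ge> N\<close> by (simp add: W_def)
      thus "x \<in> (\<Union>i. case prod_decode i of (n, k) \<Rightarrow> W n k)"
        by (intro UN_I[of "prod_encode (n, j)"]) auto
    next
      fix i
      obtain n k where nk: "prod_decode i = (n, k)" by fastforce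
      have "bounded (W n k)" using bdd[OF en] by (auto simp: W_def)
      thus "bounded (case prod_decode i of (n, k) \<Rightarrow> W n k)" by (simp add: nk)
      have "diameter (W n k) \<le> \<delta>" using diam[OF en, of k n] N[of n] that by (auto simp: W_def)
      thus "diameter (case prod_decode i of (n, k) \<Rightarrow> W n k) \<le> \<delta>" by (simp add: nk)
    qed
    hence "hausdorff_premeasure s \<delta> A \<le> (\<Sum>i. diam_powr (case prod_decode i of (n, k) \<Rightarrow> W n k) s)"
      unfolding hausdorff_premeasure_def by (intro INF_lower) auto
    also have "\<dots> = (\<Sum>i. ((\<lambda>(n, k). diam_powr (W n k) s) \<circ> prod_decode) i)"
      by (simp add: comp_def case_prod_unfold)
    also have "\<dots> = (\<Sum>n. \<Sum>k. diam_powr (W n k) s)"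
      unfolding comp_def by (rule suminf_ennreal_2dimen[unfolded comp_def]) simp
    also have "\<dots> \<le> (\<Sum>n. ennreal (if n \<ge> N then C * q ^ n else 0))"
    proof (intro suminf_le)
      fix n
      have "(\<Sum>k. diam_powr (W n k) s) = (\<Sum>k<card (I n). diam_powr (W n k) s)"
        by (rule suminf_finite) (auto simp: W_def diam_powr_def)
      also have "\<dots> \<le> (\<Sum>k<card (I n). ennreal (if n \<ge> N then d n powr s else 0))"
      proof (rule sum_mono)
        fix k assume "k \<in> {..<card (I n)}"
        hence e: "from_nat_into (I n) k \<in> I n" using en by auto
        show "diam_powr (W n k) s \<le> ennreal (if n \<ge> N then d n powr s else 0)"
          using diam[OF e] diameter_ge_0[OF bdd[OF e]] s
          by (auto simp: W_def diam_powr_def intro!: ennreal_leI powr_mono2)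
      qed
      also have "\<dots> = ennreal (if n \<ge> N then real (card (I n)) * d n powr s else 0)"
        by (simp add: ennreal_mult ennreal_of_nat_eq_real_of_nat)
      also have "\<dots> \<le> ennreal (if n \<ge> N then C * q ^ n else 0)"
        using sum[of n] by (auto intro: ennreal_leI)
      finally show "(\<Sum>k. diam_powr (W n k) s) \<le> ennreal (if n \<ge> N then C * q ^ n else 0)" .
    qed auto
    also have "\<dots> = ennreal (C * q ^ N / (1 - q))"
    proof (rule suminf_ennreal_eq)
      have "(\<lambda>n. C * q ^ N * q ^ n) sums (C * q ^ N * (1 / (1 - q)))"
        using q by (intro sums_mult geometric_sums) auto
      hence "(\<lambda>n. if n + N \<ge> N then C * q ^ (n + N) else 0) sums (C * q ^ N / (1 - q))"
        by (simp add: power_add mult_ac)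
      thus "(\<lambda>n. if n \<ge> N then C * q ^ n else 0) sums (C * q ^ N / (1 - q))"
        by (subst (asm) sums_iff_shift) simp
    qed (use C q in auto)
    also have "\<dots> \<le> ennreal e" using N[of N] by (intro ennreal_leI) (simp add: field_simps)
    finally show ?thesis .
  qed
  have "hausdorff_premeasure s \<delta> A \<le> 0" if "\<delta> > 0" for \<delta>
  proof (rule ennreal_le_epsilon)
    fix e :: real assume "0 < e"
    thus "hausdorff_premeasure s \<delta> A \<le> 0 + ennreal e" using small[OF that] by simp
  qed
  hence "hausdorff_measure s A \<le> 0"
    unfolding hausdorff_measure_def by (intro SUP_least) simp
  thus ?thesis by simp
qed

section \<open>Limits of compositions of collapsing maps\<close>

text \<open>The Lipschitz constants \<open>L n\<close> may grow without bound; only \<open>g\<close>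
  and \<open>\<kappa>\<close> have to vanish. Collapse is required on a whole neighbourhood of a
  point outside \<open>A n\<close>, because the maps composed inside \<open>\<phi> n\<close> move
  the point before \<open>\<phi> n\<close> acts.\<close>

locale collapsing_maps =
  fixes a c s :: real and \<phi> :: "nat \<Rightarrow> real \<Rightarrow> real" and A :: "nat \<Rightarrow> real set"
    and D :: "nat \<Rightarrow> real set" and g L \<kappa> \<mu> :: "nat \<Rightarrow> real"
  assumes ac: "a < c" and s: "0 < s" "s < 1"
    and maps: "\<And>n x. n > 0 \<Longrightarrow> x \<in> {a..c} \<Longrightarrow> \<phi> n x \<in> {a..c}"
    and close: "\<And>n x. n > 0 \<Longrightarrow> x \<in> {a..c} \<Longrightarrow> \<bar>\<phi> n x - x\<bar> \<le> g n"
    and lipschitz: "\<And>n x z. n > 0 \<Longrightarrow> x \<in> {a..c} \<Longrightarrow> z \<in> {a..c} \<Longrightarrow>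
      \<bar>\<phi> n x - \<phi> n z\<bar> \<le> L n * \<bar>x - z\<bar>"
    and holder: "\<And>n x z. n > 0 \<Longrightarrow> x \<in> {a..c} \<Longrightarrow> z \<in> {a..c} \<Longrightarrow>
      \<bar>\<phi> n x - \<phi> n z\<bar> \<le> 3 * \<bar>x - z\<bar> + \<kappa> n * \<bar>x - z\<bar> powr s"
    and g_lim: "g \<longlonglongrightarrow> 0" and \<kappa>_lim: "\<kappa> \<longlonglongrightarrow> 0"
    and \<mu>_pos: "\<And>n. n > 0 \<Longrightarrow> 0 < \<mu> n"
    and finite_D: "\<And>n. finite (D n)"
    and collapse: "\<And>n x z. n > 0 \<Longrightarrow> x \<in> {a..c} - A n \<Longrightarrow> z \<in> {a..c} \<Longrightarrow> \<bar>z - x\<bar> \<le> \<mu> n \<Longrightarrow>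
      \<phi> n z \<in> D n"
begin

text \<open>Two regimes. At distances of at least \<rho>, replacing \<open>\<phi> n\<close> by the
  identity costs at most 2 K g(n), which \<eta> \<rho>^s absorbs for large n. Below \<rho>, the
  Lipschitz bound of \<open>F\<close> and the estimate \<open>holder\<close> of
  \<open>\<phi> n\<close> together give the constant 1, which is at most \<open>C\<close>.\<close>

lemma eventually_holder_comp:
  assumes K: "0 < K" and C: "1 \<le> C" and \<eta>: "0 < \<eta>"
    and lipF: "\<And>x z. x \<in> {a..c} \<Longrightarrow> z \<in> {a..c} \<Longrightarrow> \<bar>F x - F z\<bar> \<le> K * \<bar>x - z\<bar>"
    and holF: "\<And>x z. x \<in> {a..c} \<Longrightarrow> z \<in> {a..c} \<Longrightarrow> \<bar>F x - F z\<bar> \<le> C * \<bar>x - z\<bar> powr s"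
  shows "\<forall>\<^sub>F n in sequentially. \<forall>x\<in>{a..c}. \<forall>z\<in>{a..c}.
    \<bar>F (\<phi> n x) - F (\<phi> n z)\<bar> \<le> (C + \<eta>) * \<bar>x - z\<bar> powr s"
proof -
  \<comment> \<open>Chosen so that r < \<rho> gives 3 K r \<le> r^s / 2; the other half of r^s is
    left for the \<kappa>-term.\<close>
  define \<rho> where "\<rho> = (1 / (6 * K)) powr (1 / (1 - s))"
  have \<rho>: "0 < \<rho>" "\<rho> powr (1 - s) = 1 / (6 * K)"
    using K s by (auto simp: \<rho>_def powr_powr)
  have "\<forall>\<^sub>F n in sequentially. \<kappa> n < 1 / (2 * K)"
    using \<kappa>_lim K by (intro order_tendstoD(2)) auto
  moreover have "\<forall>\<^sub>F n in sequentially. g n < \<eta> * \<rho> powr s / (2 * K)"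
    using g_lim K \<rho>(1) \<eta> by (intro order_tendstoD(2)) auto
  ultimately show ?thesis using eventually_gt_at_top[of 0]
  proof eventually_elim
    case (elim n)
    show ?case
    proof (intro ballI)
      fix x z assume xz: "x \<in> {a..c}" "z \<in> {a..c}"
      define r where "r = \<bar>x - z\<bar>"
      note m = maps[OF elim(3) xz(1)] maps[OF elim(3) xz(2)]
      have Fd: "\<bar>F (\<phi> n w) - F w\<bar> \<le> K * g n" if "w \<in> {a..c}" for w
        using lipF[OF maps[OF elim(3) that] that] close[OF elim(3) that] K
        by (meson mult_left_mono less_imp_le order_trans)
      show "\<bar>F (\<phi> n x) - F (\<phi> n z)\<bar> \<le> (C + \<eta>) * \<bar>x - z\<bar> powr s"
      proof (cases "\<rho> \<le> r")
        case True
        have "2 * (K * g n) \<le> \<eta> * \<rho> powr s" using elim(2) K by (simp add: field_simps)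
        also have "\<dots> \<le> \<eta> * r powr s"
          using True \<rho>(1) s \<eta> by (intro mult_left_mono powr_mono2) auto
        finally have "2 * (K * g n) \<le> \<eta> * r powr s" .
        moreover have "\<bar>F (\<phi> n x) - F (\<phi> n z)\<bar> \<le> \<bar>F x - F z\<bar> + 2 * (K * g n)"
          using Fd[OF xz(1)] Fd[OF xz(2)] by linarith
        ultimately show ?thesis using holF[OF xz] by (simp add: r_def algebra_simps)
      next
        case False
        show ?thesis
        proof (cases "x = z")
          case False
          hence r: "0 < r" by (simp add: r_def)
          have "r = r powr (1 - s) * r powr s" using r by (simp flip: powr_add)
          also have "\<dots> \<le> 1 / (6 * K) * r powr s"
            using \<open>\<not> \<rho> \<le> r\<close> r s unfolding \<rho>(2)[symmetric]
            by (intro mult_right_mono powr_mono2) auto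
          finally have r1: "r \<le> 1 / (6 * K) * r powr s" .
          have "\<kappa> n * r powr s \<le> 1 / (2 * K) * r powr s"
            using elim(1) by (intro mult_right_mono) auto
          hence "3 * r + \<kappa> n * r powr s \<le> 1 / K * r powr s" using r1 by (simp add: field_simps)
          hence "\<bar>\<phi> n x - \<phi> n z\<bar> \<le> 1 / K * r powr s"
            using holder[OF elim(3) xz] unfolding r_def by linarith
          hence "K * \<bar>\<phi> n x - \<phi> n z\<bar> \<le> r powr s" using K by (simp add: field_simps)
          hence "\<bar>F (\<phi> n x) - F (\<phi> n z)\<bar> \<le> 1 * r powr s" using lipF[OF m] by simp
          also have "\<dots> \<le> (C + \<eta>) * r powr s" using C \<eta> by (intro mult_right_mono) auto
          finally show ?thesis by (simp add: r_def)
        qed simp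
      qed
    qed
  qed
qed

lemma holder_id: "x \<in> {a..c} \<Longrightarrow> z \<in> {a..c} \<Longrightarrow> \<bar>x - z\<bar> \<le> (c - a) powr (1 - s) * \<bar>x - z\<bar> powr s"
proof (cases "x = z")
  case False
  assume xz: "x \<in> {a..c}" "z \<in> {a..c}"
  have "\<bar>x - z\<bar> = \<bar>x - z\<bar> powr (1 - s) * \<bar>x - z\<bar> powr s"
    using False by (simp flip: powr_add)
  also have "\<dots> \<le> (c - a) powr (1 - s) * \<bar>x - z\<bar> powr s"
    using xz s by (intro mult_right_mono powr_mono2) auto
  finally show ?thesis .
qed simp

text \<open>The stages are the compositions \<open>F k = \<phi> (N 1) \<circ> \<dots> \<circ> \<phi> (N k)\<close>. The quantity \<open>M k\<close> is the least
  margin \<open>\<mu>\<close> of the maps used so far; later maps move points by so little that their total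
  displacement stays below it.\<close>

lemma stages:
  assumes e: "0 < e"
  obtains C :: real and N :: "nat \<Rightarrow> nat" and F :: "nat \<Rightarrow> real \<Rightarrow> real" and M :: "nat \<Rightarrow> real"
  where "0 < C" "strict_mono N" "F 0 = (\<lambda>x. x)" "\<And>k. F (Suc k) = (\<lambda>x. F k (\<phi> (N (Suc k)) x))"
    "\<And>k. 0 < M k" "\<And>k. M (Suc k) \<le> M k" "\<And>k. M (Suc k) \<le> \<mu> (N (Suc k))"
    "\<And>k. g (N (Suc k)) \<le> M k * (1/2) ^ Suc k"
    "\<And>k x. x \<in> {a..c} \<Longrightarrow> \<bar>F (Suc k) x - F k x\<bar> \<le> e * (1/2) ^ Suc k"
    "\<And>k x z. x \<in> {a..c} \<Longrightarrow> z \<in> {a..c} \<Longrightarrow> \<bar>F k x - F k z\<bar> \<le> C * \<bar>x - z\<bar> powr s"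
proof -
  \<comment> \<open>The identity is s-Hoelder with constant (c - a)^(1-s); the summand 1 secures the
    hypothesis \<open>1 \<le> C\<close> of \<open>eventually_holder_comp\<close>.\<close>
  define C where "C = 1 + (c - a) powr (1 - s)"
  \<comment> \<open>The Lipschitz constant \<open>K\<close> is chosen anew at each stage and may
    explode. The Hoelder constant starts at \<open>C\<close> and grows by (1/2)^(k+1) at stage k, so
    it stays below \<open>C + 1\<close>.\<close>
  define P where "P k st = (case st of (n, F, m) \<Rightarrow> (0::real) < m \<and>
      (k = 0 \<longrightarrow> F = (\<lambda>x. x)) \<and>
      (\<exists>K>0. \<forall>x\<in>{a..c}. \<forall>z\<in>{a..c}. \<bar>F x - F z\<bar> \<le> K * \<bar>x - z\<bar>) \<and>
      (\<forall>x\<in>{a..c}. \<forall>z\<in>{a..c}. \<bar>F x - F z\<bar> \<le> (C + 1 - (1/2) ^ k) * \<bar>x - z\<bar> powr s))"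
    for k and st :: "nat \<times> (real \<Rightarrow> real) \<times> real"
  define Q where "Q k st st' = (case st of (n, F, m) \<Rightarrow> case st' of (n', F', m') \<Rightarrow>
      n < n' \<and> F' = (\<lambda>x. F (\<phi> n' x)) \<and> m' \<le> m \<and> m' \<le> \<mu> n' \<and> g n' \<le> m * (1/2) ^ Suc k \<and>
      (\<forall>x\<in>{a..c}. \<bar>F' x - F x\<bar> \<le> e * (1/2) ^ Suc k))"
    for k and st st' :: "nat \<times> (real \<Rightarrow> real) \<times> real"
  have "\<exists>f. \<forall>k. P k (f k) \<and> Q k (f k) (f (Suc k))"
  proof (rule dependent_nat_choice)
    have "\<bar>x - z\<bar> \<le> C * \<bar>x - z\<bar> powr s" if "x \<in> {a..c}" "z \<in> {a..c}" for x z
      by (rule order_trans[OF holder_id[OF that]], intro mult_right_mono) (auto simp: C_def)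
    hence "P 0 (0, \<lambda>x. x, 1)" unfolding P_def by (auto intro!: exI[of _ 1])
    thus "\<exists>st. P 0 st" by blast
  next
    fix st k assume "P k st"
    obtain n F m where st: "st = (n, F, m)" by (cases st)
    obtain K where m: "0 < m" and K: "0 < K"
      and lipF: "\<And>x z. x \<in> {a..c} \<Longrightarrow> z \<in> {a..c} \<Longrightarrow> \<bar>F x - F z\<bar> \<le> K * \<bar>x - z\<bar>"
      and holF: "\<And>x z. x \<in> {a..c} \<Longrightarrow> z \<in> {a..c} \<Longrightarrow>
        \<bar>F x - F z\<bar> \<le> (C + 1 - (1/2) ^ k) * \<bar>x - z\<bar> powr s"
      using \<open>P k st\<close> unfolding P_def st by auto
    have "(1/2 :: real) ^ k \<le> 1" by (intro power_le_one) auto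
    moreover have "1 \<le> C" by (simp add: C_def)
    ultimately have C1: "1 \<le> C + 1 - (1/2) ^ k" by linarith
    have "\<forall>\<^sub>F n in sequentially. g n < m * (1/2) ^ Suc k"
      using g_lim m by (intro order_tendstoD(2)) auto
    moreover have "\<forall>\<^sub>F n in sequentially. g n < e * (1/2) ^ Suc k / K"
      using g_lim K e by (intro order_tendstoD(2)) auto
    moreover have "\<forall>\<^sub>F n in sequentially. \<forall>x\<in>{a..c}. \<forall>z\<in>{a..c}.
        \<bar>F (\<phi> n x) - F (\<phi> n z)\<bar> \<le> (C + 1 - (1/2) ^ k + (1/2) ^ Suc k) * \<bar>x - z\<bar> powr s"
      by (rule eventually_holder_comp[OF K C1 _ lipF holF]) auto
    ultimately have "\<forall>\<^sub>F n' in sequentially. n < n' \<and> g n' < m * (1/2) ^ Suc k \<and>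
        g n' < e * (1/2) ^ Suc k / K \<and> (\<forall>x\<in>{a..c}. \<forall>z\<in>{a..c}.
        \<bar>F (\<phi> n' x) - F (\<phi> n' z)\<bar> \<le> (C + 1 - (1/2) ^ k + (1/2) ^ Suc k) * \<bar>x - z\<bar> powr s)"
      using eventually_gt_at_top[of n] by eventually_elim auto
    then obtain n' where n': "n < n'" "g n' < m * (1/2) ^ Suc k" "g n' < e * (1/2) ^ Suc k / K"
      and hol': "\<forall>x\<in>{a..c}. \<forall>z\<in>{a..c}.
        \<bar>F (\<phi> n' x) - F (\<phi> n' z)\<bar> \<le> (C + 1 - (1/2) ^ k + (1/2) ^ Suc k) * \<bar>x - z\<bar> powr s"
      using eventually_happens'[OF sequentially_bot] by blast
    have n'0: "n' > 0" using n'(1) by simp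
    have "\<bar>F (\<phi> n' x) - F x\<bar> \<le> e * (1/2) ^ Suc k" if x: "x \<in> {a..c}" for x
    proof -
      have "\<bar>F (\<phi> n' x) - F x\<bar> \<le> K * \<bar>\<phi> n' x - x\<bar>" by (rule lipF[OF maps[OF n'0 x] x])
      also have "\<dots> \<le> K * g n'" using K close[OF n'0 x] by (intro mult_left_mono) auto
      also have "\<dots> \<le> e * (1/2) ^ Suc k" using n'(3) K by (simp add: field_simps)
      finally show ?thesis .
    qed
    hence "Q k st (n', \<lambda>x. F (\<phi> n' x), min m (\<mu> n'))"
      using n' unfolding Q_def st by auto
    moreover have "P (Suc k) (n', \<lambda>x. F (\<phi> n' x), min m (\<mu> n'))"
    proof -
      \<comment> \<open>The maximum with 1 keeps the new Lipschitz constant positive, as the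
        invariant demands.\<close>
      have "\<bar>F (\<phi> n' x) - F (\<phi> n' z)\<bar> \<le> (K * max 1 (L n')) * \<bar>x - z\<bar>"
        if xz: "x \<in> {a..c}" "z \<in> {a..c}" for x z
      proof -
        have "\<bar>\<phi> n' x - \<phi> n' z\<bar> \<le> max 1 (L n') * \<bar>x - z\<bar>"
          using lipschitz[OF n'0 xz] by (rule order_trans) (intro mult_right_mono, auto)
        hence "K * \<bar>\<phi> n' x - \<phi> n' z\<bar> \<le> K * (max 1 (L n') * \<bar>x - z\<bar>)"
          using K by (intro mult_left_mono) auto
        thus ?thesis using lipF[OF maps[OF n'0 xz(1)] maps[OF n'0 xz(2)]] by (simp add: mult.assoc)
      qed
      moreover have "0 < K * max 1 (L n')" using K by (simp add: less_max_iff_disj)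
      moreover have "C + 1 - (1/2) ^ k + (1/2) ^ Suc k = C + 1 - (1/2) ^ Suc k" by simp
      ultimately show ?thesis using hol' m \<mu>_pos[OF n'0] unfolding P_def by auto
    qed
    ultimately show "\<exists>st'. P (Suc k) st' \<and> Q k st st'" by blast
  qed
  then obtain f where f: "\<And>k. P k (f k)" "\<And>k. Q k (f k) (f (Suc k))" by blast
  define N where "N k = fst (f k)" for k
  define F where "F k = fst (snd (f k))" for k
  define M where "M k = snd (snd (f k))" for k
  have fk: "f k = (N k, F k, M k)" for k by (simp add: N_def F_def M_def)
  show ?thesis
  proof (rule that[of "C + 1" N F M])
    show "0 < C + 1" by (simp add: C_def add_pos_nonneg)
    show "strict_mono N" using f(2) by (simp add: strict_mono_Suc_iff Q_def fk)
    show "F 0 = (\<lambda>x. x)" using f(1)[of 0] by (simp add: P_def fk)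
    fix k
    show "F (Suc k) = (\<lambda>x. F k (\<phi> (N (Suc k)) x))" "M (Suc k) \<le> M k" "M (Suc k) \<le> \<mu> (N (Suc k))"
      "g (N (Suc k)) \<le> M k * (1/2) ^ Suc k"
      using f(2)[of k] by (simp_all add: Q_def fk)
    show "0 < M k" using f(1)[of k] by (simp add: P_def fk)
    show "\<bar>F (Suc k) x - F k x\<bar> \<le> e * (1/2) ^ Suc k" if "x \<in> {a..c}" for x
      using f(2)[of k] that unfolding Q_def fk prod.case by blast
    fix x z assume xz: "x \<in> {a..c}" "z \<in> {a..c}"
    have "\<bar>F k x - F k z\<bar> \<le> (C + 1 - (1/2) ^ k) * \<bar>x - z\<bar> powr s"
      using f(1)[of k] xz by (simp add: P_def fk)
    also have "\<dots> \<le> (C + 1) * \<bar>x - z\<bar> powr s" by (intro mult_right_mono) auto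
    finally show "\<bar>F k x - F k z\<bar> \<le> (C + 1) * \<bar>x - z\<bar> powr s" .
  qed
qed

text \<open>The stages converge to a continuous map close to the identity, so its image contains an
  interval. A point missing some \<open>A (N (Suc k))\<close> is sent into a finite set, and these
  sets have a countable union.\<close>

lemma holder_image_limsup:
  obtains f :: "real \<Rightarrow> real" and C p q :: real and Z :: "real set"
  where "0 < C" "p < q" "countable Z"
    "\<And>x z. x \<in> {a..c} \<Longrightarrow> z \<in> {a..c} \<Longrightarrow> \<bar>f x - f z\<bar> \<le> C * \<bar>x - z\<bar> powr s"
    "{p..q} - Z \<subseteq> f ` {x \<in> {a..c}. infinite {n. n > 0 \<and> x \<in> A n}}"
proof -
  \<comment> \<open>The displacements of the stages add up to at most \<open>e\<close>, so the limit
    map moves neither endpoint by more than a third of the interval and attains every value in the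
    middle third.\<close>
  define e where "e = (c - a) / 3"
  have e: "0 < e" using ac by (simp add: e_def)
  show ?thesis
  proof (rule stages[OF e])
    fix C N F M assume C: "0 < C" and N: "strict_mono N" and F0: "F 0 = (\<lambda>x. x)"
    and FS: "\<And>k. F (Suc k) = (\<lambda>x. F k (\<phi> (N (Suc k)) x))"
    and M: "\<And>k. 0 < M k" "\<And>k. M (Suc k) \<le> M k" "\<And>k. M (Suc k) \<le> \<mu> (N (Suc k))"
    and gM: "\<And>k. g (N (Suc k)) \<le> M k * (1/2) ^ Suc k"
    and step: "\<And>k x. x \<in> {a..c} \<Longrightarrow> \<bar>F (Suc k) x - F k x\<bar> \<le> e * (1/2) ^ Suc k"
    and holF: "\<And>k x z. x \<in> {a..c} \<Longrightarrow> z \<in> {a..c} \<Longrightarrow> \<bar>F k x - F k z\<bar> \<le> C * \<bar>x - z\<bar> powr s"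
  have N0: "N (Suc k) > 0" for k
    using N by (metis gr_zeroI lessI not_less_zero strict_mono_less)
  define f where "f x = lim (\<lambda>k. F k x)" for x
  have F_lim: "(\<lambda>k. F k x) \<longlonglongrightarrow> f x" if "x \<in> {a..c}" for x
  proof -
    have "summable (\<lambda>k. e * (1/2) ^ Suc k)" by (intro summable_mult summable_Suc_iff[THEN iffD2] summable_geometric) auto
    hence "summable (\<lambda>k. F (Suc k) x - F k x)"
      by (rule summable_comparison_test'[of _ 0]) (simp only: real_norm_def step[OF that])
    hence "(\<lambda>n. \<Sum>k<n. F (Suc k) x - F k x) \<longlonglongrightarrow> (\<Sum>k. F (Suc k) x - F k x)"
      by (rule summable_LIMSEQ)
    hence "convergent (\<lambda>n. F n x - F 0 x)"
      unfolding sum_lessThan_telescope[of "\<lambda>k. F k x"] convergent_def by (rule exI)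
    thus ?thesis unfolding f_def by (simp only: convergent_diff_const_right_iff convergent_LIMSEQ_iff)
  qed
  have F_near: "\<bar>F k x - x\<bar> \<le> e * (1 - (1/2) ^ k)" if "x \<in> {a..c}" for k x
  proof (induction k)
    case (Suc k)
    have "\<bar>F (Suc k) x - x\<bar> \<le> e * (1/2) ^ Suc k + e * (1 - (1/2) ^ k)"
      using step[OF that, of k] Suc by linarith
    also have "\<dots> = e * (1 - (1/2) ^ Suc k)" by (simp add: algebra_simps)
    finally show ?case .
  qed (simp add: F0)
  have f_near: "\<bar>f x - x\<bar> \<le> e" if "x \<in> {a..c}" for x
  proof (rule LIMSEQ_le_const2)
    show "(\<lambda>k. \<bar>F k x - x\<bar>) \<longlonglongrightarrow> \<bar>f x - x\<bar>" by (intro tendsto_intros F_lim that)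
    have "\<bar>F k x - x\<bar> \<le> e" for k
      using e by (intro order_trans[OF F_near[OF that]] mult_left_le) auto
    thus "\<exists>N. \<forall>n\<ge>N. \<bar>F n x - x\<bar> \<le> e" by blast
  qed
  have holf: "\<bar>f x - f z\<bar> \<le> C * \<bar>x - z\<bar> powr s" if "x \<in> {a..c}" "z \<in> {a..c}" for x z
  proof (rule LIMSEQ_le_const2)
    show "(\<lambda>k. \<bar>F k x - F k z\<bar>) \<longlonglongrightarrow> \<bar>f x - f z\<bar>" by (intro tendsto_intros F_lim that)
    show "\<exists>N. \<forall>n\<ge>N. \<bar>F n x - F n z\<bar> \<le> C * \<bar>x - z\<bar> powr s" using holF[OF that] by blast
  qed
  have "continuous_on {a..c} f"
    unfolding continuous_on_def
  proof
    fix x assume x: "x \<in> {a..c}"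
    have "((\<lambda>z. C * \<bar>z - x\<bar> powr s) \<longlongrightarrow> C * \<bar>x - x\<bar> powr s) (at x within {a..c})"
      using s by (intro tendsto_intros) auto
    hence "((\<lambda>z. C * \<bar>z - x\<bar> powr s) \<longlongrightarrow> 0) (at x within {a..c})" using s by simp
    moreover have "\<forall>\<^sub>F z in at x within {a..c}. norm (f z - f x) \<le> C * \<bar>z - x\<bar> powr s"
      using holf[OF _ x] by (auto simp: eventually_at_filter)
    ultimately have "((\<lambda>z. f z - f x) \<longlongrightarrow> 0) (at x within {a..c})"
      by (rule Lim_null_comparison[rotated])
    thus "(f \<longlongrightarrow> f x) (at x within {a..c})" by (rule LIM_zero_cancel)
  qed
  moreover have "f a \<le> a + e" "c - e \<le> f c" using f_near[of a] f_near[of c] ac by auto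
  ultimately have surj: "\<exists>x\<in>{a..c}. f x = t" if "t \<in> {a + e..c - e}" for t
    using IVT'[of f a t c] that ac by auto
  \<comment> \<open>The exceptional values: everything that a collapse at some stage can
    produce.\<close>
  define Z where "Z = (\<Union>k. F k ` D (N (Suc k)))"
  \<comment> \<open>Here z is the image of x under the inner maps with indices
    \<open>N (Suc k)\<close> to \<open>N j\<close>. Since \<open>M\<close> decreases, each of them
    moves its argument by at most \<open>M k\<close> times a power of 1/2, and the total stays below
    the margin \<open>M k\<close>.\<close>
  have tail: "\<exists>z\<in>{a..c}. F j x = F k z \<and> \<bar>z - x\<bar> \<le> M k * (1 - (1/2) ^ j)"
    if "k \<le> j" "x \<in> {a..c}" for k j x
    using that
  proof (induction j arbitrary: x rule: dec_induct)
    case base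
    have "(1/2 :: real) ^ k \<le> 1" by (intro power_le_one) auto
    thus ?case using base M(1)[of k] by (intro bexI[of _ x]) auto
  next
    case (step j)
    define x' where "x' = \<phi> (N (Suc j)) x"
    have x': "x' \<in> {a..c}" unfolding x'_def by (rule maps[OF N0 step.prems])
    obtain z where z: "z \<in> {a..c}" "F j x' = F k z" "\<bar>z - x'\<bar> \<le> M k * (1 - (1/2) ^ j)"
      using step.IH[OF x'] by blast
    have "M j \<le> M k" by (rule lift_Suc_antimono_le[of M, OF M(2) step.hyps(1)])
    hence "M j * (1/2) ^ Suc j \<le> M k * (1/2) ^ Suc j" by (intro mult_right_mono) auto
    hence "\<bar>x' - x\<bar> \<le> M k * (1/2) ^ Suc j"
      using close[OF N0 step.prems, of j] gM[of j] unfolding x'_def by linarith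
    hence "\<bar>z - x\<bar> \<le> M k * (1 - (1/2) ^ j) + M k * (1/2) ^ Suc j" using z(3) by linarith
    also have "\<dots> = M k * (1 - (1/2) ^ Suc j)" by (simp add: algebra_simps)
    finally have "\<bar>z - x\<bar> \<le> M k * (1 - (1/2) ^ Suc j)" .
    moreover have "F (Suc j) x = F k z" using z(2) by (simp add: FS x'_def)
    ultimately show ?case using z(1) by blast
  qed
  have in_A: "x \<in> A (N (Suc k))" if x: "x \<in> {a..c}" and "f x \<notin> Z" for x k
  proof (rule ccontr)
    assume nA: "x \<notin> A (N (Suc k))"
    have "F j x \<in> F k ` D (N (Suc k))" if j: "Suc k \<le> j" for j
    proof -
      obtain z where z: "z \<in> {a..c}" "F j x = F (Suc k) z"
        "\<bar>z - x\<bar> \<le> M (Suc k) * (1 - (1/2) ^ j)"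
        using tail[OF j x] by blast
      have "M (Suc k) * (1 - (1/2) ^ j) \<le> M (Suc k)" using M(1)[of "Suc k"] by simp
      hence "\<bar>z - x\<bar> \<le> \<mu> (N (Suc k))" using z(3) M(3)[of k] by linarith
      hence "\<phi> (N (Suc k)) z \<in> D (N (Suc k))" using x nA z(1) by (intro collapse[OF N0, of x]) auto
      thus ?thesis using z(2) by (simp add: FS)
    qed
    \<comment> \<open>All stages from \<open>Suc k\<close> on take values at x in one finite, hence
      closed, set, so the limit lies there too.\<close>
    hence "f x \<in> F k ` D (N (Suc k))"
      using finite_D F_lim[OF x]
      by (intro Lim_in_closed_set[of "F k ` D (N (Suc k))" _ sequentially] finite_imp_closed)
         (auto simp: eventually_sequentially)
    thus False using \<open>f x \<notin> Z\<close> by (auto simp: Z_def)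
  qed
  show ?thesis
  proof (rule that[of C "a + e" "c - e" Z f])
    show "a + e < c - e" using ac by (simp add: e_def field_simps)
    show "countable Z" unfolding Z_def
      by (rule countable_UN) (simp_all add: countable_finite finite_D)
    show "{a + e..c - e} - Z \<subseteq> f ` {x \<in> {a..c}. infinite {n. n > 0 \<and> x \<in> A n}}"
    proof
      fix t assume t: "t \<in> {a + e..c - e} - Z"
      then obtain x where x: "x \<in> {a..c}" "f x = t" using surj by blast
      have "range (\<lambda>k. N (Suc k)) \<subseteq> {n. n > 0 \<and> x \<in> A n}" using in_A[OF x(1)] x(2) t N0 by auto
      moreover have "inj (\<lambda>k. N (Suc k))" using strict_mono_imp_inj_on[OF N] by (auto simp: inj_def)
      hence "infinite (range (\<lambda>k. N (Suc k)))" by (rule range_inj_infinite)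
      ultimately have "infinite {n. n > 0 \<and> x \<in> A n}" using finite_subset by blast
      thus "t \<in> f ` {x \<in> {a..c}. infinite {n. n > 0 \<and> x \<in> A n}}" using x by blast
    qed
  qed (use C holf in auto)
  qed
qed

end

section \<open>The snapping maps: staircases and roots\<close>

text \<open>For l at least 1 this is a continuous increasing staircase with plateaus at the
  half-integers: it climbs with slope l within 1/(2l) of each integer and is constant elsewhere.
  Adjacent cells agree at the common endpoint m + 1/2.\<close>

definition staircase :: "real \<Rightarrow> real \<Rightarrow> real" where
  "staircase l u = of_int (round u) + max (-1/2) (min (1/2) (l * (u - of_int (round u))))"

lemma round_error: "u - of_int (round u) \<in> {-1/2..1/2}"
  using of_int_round_abs_le[of u] unfolding abs_le_iff by auto

lemma staircase_near: "\<bar>staircase l u - u\<bar> \<le> 1"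
  using round_error[of u] unfolding staircase_def by auto

lemma staircase_lipschitz:
  assumes "1 \<le> l"
  shows "\<bar>staircase l u - staircase l v\<bar> \<le> l * \<bar>u - v\<bar>"
proof -
  have *: "\<bar>staircase l u - staircase l v\<bar> \<le> l * (v - u)" if "u \<le> v" for u v
  proof (cases "round u = round v")
    case True
    define m where "m = real_of_int (round v)"
    have "l * (u - m) \<le> l * (v - m)" using that assms by simp
    hence "\<bar>max (-1/2) (min (1/2) (l * (u - m))) - max (-1/2) (min (1/2) (l * (v - m)))\<bar>
        \<le> l * (v - m) - l * (u - m)" by linarith
    thus ?thesis using True by (simp add: staircase_def m_def algebra_simps)
  next
    case False
    define m m' where "m = real_of_int (round u)" "m' = real_of_int (round v)"
    have mm: "m + 1 \<le> m'" using round_mono[OF that] False unfolding m_m'_def by linarith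
    have b: "m - 1/2 \<le> u" "u \<le> m + 1/2" "m' - 1/2 \<le> v" "v \<le> m' + 1/2"
      using round_error[of u] round_error[of v] by (auto simp: m_m'_def)
    \<comment> \<open>P and R are l times the distance from u to the right end of its cell and from
      v to the left end of its cell. Each of the m' - 1 - m whole cells between them has rise 1,
      which is at most l.\<close>
    define P R where "P = l * (m + 1/2 - u)" "R = l * (v - (m' - 1/2))"
    have PR: "0 \<le> P" "0 \<le> R" using assms b by (simp_all add: P_R_def)
    have "l * (u - m) = l/2 - P" "l * (v - m') = R - l/2" by (simp_all add: P_R_def algebra_simps)
    hence "staircase l u = m + max (-1/2) (min (1/2) (l/2 - P))"
      "staircase l v = m' + max (-1/2) (min (1/2) (R - l/2))"
      by (simp_all add: staircase_def m_m'_def)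
    hence "m + 1/2 - P \<le> staircase l u" "staircase l u \<le> m + 1/2"
      "staircase l v \<le> m' - 1/2 + R" "m' - 1/2 \<le> staircase l v"
      using assms PR by (auto simp: max_def min_def)
    moreover have "m' - 1 - m \<le> l * (m' - 1 - m)"
      using assms mm mult_right_mono[of 1 l "m' - 1 - m"] by simp
    moreover have "l * (v - u) = P + R + l * (m' - 1 - m)"
      by (simp add: P_R_def algebra_simps)
    ultimately have "staircase l v - staircase l u \<le> l * (v - u)" by argo
    moreover have "0 \<le> staircase l v - staircase l u"
      using \<open>staircase l u \<le> m + 1/2\<close> \<open>m' - 1/2 \<le> staircase l v\<close> mm by argo
    ultimately show ?thesis by simp
  qed
  show ?thesis using *[of u v] *[of v u] by (cases "u \<le> v") (auto simp: abs_minus_commute)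
qed

text \<open>Far from all integers the clamp is saturated, so the value is the nearest integer plus
  or minus 1/2. The window around \<open>floor u\<close> makes the list of possible values finite
  over a bounded range of u.\<close>

lemma staircase_flat:
  assumes "0 < l" "\<And>m. 1 / (2 * l) \<le> \<bar>u - of_int m\<bar>"
  shows "staircase l u - 1/2 \<in> of_int ` {floor u - 2..floor u + 2}"
proof -
  define m where "m = round u"
  have "1/2 \<le> l * \<bar>u - of_int m\<bar>" using assms(1) assms(2)[of m] by (simp add: field_simps)
  hence "1/2 \<le> \<bar>l * (u - of_int m)\<bar>" using assms(1) by (simp add: abs_mult)
  hence "staircase l u - 1/2 = of_int m \<or> staircase l u - 1/2 = of_int (m - 1)"
    unfolding staircase_def m_def[symmetric] by auto
  moreover have "m \<in> {floor u - 1..floor u + 1}"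
    using round_error[of u] unfolding m_def by (auto; linarith)
  ultimately show ?thesis by (auto intro: image_eqI[of _ _ m] image_eqI[of _ _ "m - 1"])
qed

text \<open>Snapping can push x^n out of [a^n, c^n]; the clamp brings it back, so that the root
  stays in [a, c].\<close>

definition clamped_root :: "real \<Rightarrow> real \<Rightarrow> nat \<Rightarrow> real \<Rightarrow> real" where
  "clamped_root a c n p = root n (max (a ^ n) (min (c ^ n) p))"

lemma clamped_root_power:
  assumes "0 < a" "a \<le> x" "x \<le> c" "0 < n"
  shows "clamped_root a c n (x ^ n) = x"
proof -
  have "a ^ n \<le> x ^ n" "x ^ n \<le> c ^ n" using assms by (auto intro!: power_mono)
  thus ?thesis using assms by (simp add: clamped_root_def real_root_power_cancel)
qed

lemma clamped_root_range:
  assumes "0 < a" "a \<le> c" "0 < n"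
  shows "clamped_root a c n p \<in> {a..c}"
    and "clamped_root a c n p ^ n = max (a ^ n) (min (c ^ n) p)"
proof -
  have "a ^ n \<le> c ^ n" "0 < a ^ n" using assms by (auto intro: power_mono)
  hence *: "a ^ n \<le> max (a ^ n) (min (c ^ n) p)" "max (a ^ n) (min (c ^ n) p) \<le> c ^ n"
    "0 \<le> max (a ^ n) (min (c ^ n) p)" by auto
  have "root n (a ^ n) \<le> clamped_root a c n p" "clamped_root a c n p \<le> root n (c ^ n)"
    unfolding clamped_root_def using *(1,2) assms(3) by (simp_all only: real_root_le_iff)
  thus "clamped_root a c n p \<in> {a..c}" using assms by (simp add: real_root_power_cancel)
  show "clamped_root a c n p ^ n = max (a ^ n) (min (c ^ n) p)"
    unfolding clamped_root_def using assms *(3) by (intro real_root_pow_pos2) auto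
qed

text \<open>Mean value theorem: the derivative of the n-th power on [a, c] lies between its values
  at the endpoints.\<close>

lemma power_diff_bounds:
  fixes a c x z :: real
  assumes "0 < a" "x \<in> {a..c}" "z \<in> {a..c}" "0 < n"
  shows "real n * a ^ (n - 1) * \<bar>x - z\<bar> \<le> \<bar>x ^ n - z ^ n\<bar>"
    and "\<bar>x ^ n - z ^ n\<bar> \<le> real n * c ^ (n - 1) * \<bar>x - z\<bar>"
proof -
  have *: "\<exists>\<xi>\<in>{a..c}. \<bar>x ^ n - z ^ n\<bar> = real n * \<xi> ^ (n - 1) * \<bar>x - z\<bar>"
    if xz: "x < z" "x \<in> {a..c}" "z \<in> {a..c}" for x z
  proof -
    have "\<exists>\<xi>. x < \<xi> \<and> \<xi> < z \<and> z ^ n - x ^ n = (z - x) * (real n * \<xi> ^ (n - 1))"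
      using xz(1) by (intro MVT2) (auto intro!: derivative_eq_intros)
    then obtain \<xi> where \<xi>: "x < \<xi>" "\<xi> < z" "z ^ n - x ^ n = (z - x) * (real n * \<xi> ^ (n - 1))"
      by blast
    have "x ^ n \<le> z ^ n" using xz assms(1) by (intro power_mono) auto
    thus ?thesis using \<xi> xz by (intro bexI[of _ \<xi>]) (auto simp: mult_ac)
  qed
  have "\<exists>\<xi>\<in>{a..c}. \<bar>x ^ n - z ^ n\<bar> = real n * \<xi> ^ (n - 1) * \<bar>x - z\<bar>"
  proof (cases x z rule: linorder_cases)
    case greater
    show ?thesis using *[OF greater assms(3,2)] by (simp only: abs_minus_commute)
  qed (use *[OF _ assms(2,3)] assms(2) in auto)
  then obtain \<xi> where \<xi>: "\<xi> \<in> {a..c}" "\<bar>x ^ n - z ^ n\<bar> = real n * \<xi> ^ (n - 1) * \<bar>x - z\<bar>"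
    by blast
  have "a ^ (n - 1) \<le> \<xi> ^ (n - 1)" "\<xi> ^ (n - 1) \<le> c ^ (n - 1)"
    using \<xi>(1) assms(1) by (auto intro!: power_mono)
  thus "real n * a ^ (n - 1) * \<bar>x - z\<bar> \<le> \<bar>x ^ n - z ^ n\<bar>"
    and "\<bar>x ^ n - z ^ n\<bar> \<le> real n * c ^ (n - 1) * \<bar>x - z\<bar>"
    unfolding \<xi>(2) by (auto intro!: mult_right_mono mult_left_mono)
qed

lemma clamped_root_lipschitz:
  assumes "0 < a" "a \<le> c" "0 < n"
  shows "real n * a ^ (n - 1) * \<bar>clamped_root a c n p - clamped_root a c n q\<bar> \<le> \<bar>p - q\<bar>"
proof -
  note r = clamped_root_range[OF assms]
  have "real n * a ^ (n - 1) * \<bar>clamped_root a c n p - clamped_root a c n q\<bar>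
      \<le> \<bar>max (a ^ n) (min (c ^ n) p) - max (a ^ n) (min (c ^ n) q)\<bar>"
    using power_diff_bounds(1)[OF assms(1) r(1) r(1) assms(3), of p q] by (simp only: r(2))
  also have "\<dots> \<le> \<bar>p - q\<bar>" by linarith
  finally show ?thesis .
qed

text \<open>The weighted geometric mean of two bounds; it turns a displacement bound and a Lipschitz
  bound into a Hoelder bound.\<close>

lemma powr_interpolate:
  fixes s :: real
  assumes "0 \<le> t" "t \<le> u" "t \<le> w" "0 < s" "s < 1"
  shows "t \<le> u powr (1 - s) * w powr s"
proof (cases "t = 0")
  case False
  hence "t = t powr (1 - s) * t powr s" using assms(1) by (simp flip: powr_add)
  also have "\<dots> \<le> u powr (1 - s) * w powr s" using assms by (intro mult_mono powr_mono2) auto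
  finally show ?thesis .
qed simp

lemma power_powr: "0 < x \<Longrightarrow> (x ^ n) powr s = (x powr s) ^ n" for x s :: real
  by (simp add: powr_powr mult.commute flip: powr_realpow)

lemma nearest_int_dist_le: "nearest_int_dist t \<le> \<bar>t - of_int m\<bar>"
  unfolding nearest_int_dist_def using infdist_le[of "of_int m" \<int> t] by (simp add: dist_real_def)

lemma snap_collapsing_maps:
  fixes a b c s :: real and y :: "nat \<Rightarrow> real"
  assumes b: "1 < b" and a: "1 < a" "a < c" and s: "0 < s" "s < 1" and small: "(b * c) powr s < a"
  defines "\<phi> \<equiv> \<lambda>n x. clamped_root a c n (y n + staircase (b ^ n) (x ^ n - y n))"
  shows "collapsing_maps a c s \<phi> (\<lambda>n. {x. nearest_int_dist (x ^ n - y n) < 1 / b ^ n})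
    (\<lambda>n. (\<lambda>m. clamped_root a c n (y n + (of_int m + 1/2))) `
      {floor (a ^ n - y n) - 2..floor (c ^ n - y n) + 2})
    (\<lambda>n. a * (1/a) ^ n) (\<lambda>n. (b * c / a) ^ n)
    (\<lambda>n. (3 * (a * (1/a) ^ n)) powr (1 - s) * ((b * c / a) ^ n) powr s)
    (\<lambda>n. 1 / b ^ n / (2 * real n * c ^ (n - 1)))"
proof -
  have a0: "0 < a" "a \<le> c" using a by auto
  \<comment> \<open>The staircase changes x^n by at most 1, and the root has Lipschitz constant 1 /
    (n a^(n-1)) there; the factor n is discarded.\<close>
  have near: "\<bar>\<phi> n x - x\<bar> \<le> a * (1/a) ^ n" if n: "0 < n" and x: "x \<in> {a..c}" for n x
  proof -
    have "real n * a ^ (n - 1) * \<bar>\<phi> n x - x\<bar> \<le> 1"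
      using clamped_root_lipschitz[OF a0 n, of "y n + staircase (b ^ n) (x ^ n - y n)" "x ^ n"]
        clamped_root_power[of a x c n] staircase_near[of "b ^ n" "x ^ n - y n"] x n a0
      by (simp add: \<phi>_def)
    moreover have "1 * a ^ (n - 1) * \<bar>\<phi> n x - x\<bar> \<le> real n * a ^ (n - 1) * \<bar>\<phi> n x - x\<bar>"
      using n a0 by (intro mult_right_mono) auto
    ultimately have "a ^ (n - 1) * \<bar>\<phi> n x - x\<bar> \<le> 1" by simp
    moreover have "a ^ n = a * a ^ (n - 1)" using n by (cases n) auto
    ultimately show ?thesis using a0 by (simp add: field_simps power_one_over)
  qed
  have lip: "\<bar>\<phi> n x - \<phi> n z\<bar> \<le> (b * c / a) ^ n * \<bar>x - z\<bar>"
    if n: "0 < n" and xz: "x \<in> {a..c}" "z \<in> {a..c}" for n x z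
  proof -
    have "real n * a ^ (n - 1) * \<bar>\<phi> n x - \<phi> n z\<bar>
        \<le> \<bar>staircase (b ^ n) (x ^ n - y n) - staircase (b ^ n) (z ^ n - y n)\<bar>"
      using clamped_root_lipschitz[OF a0 n, of "y n + staircase (b ^ n) (x ^ n - y n)"
          "y n + staircase (b ^ n) (z ^ n - y n)"] by (simp add: \<phi>_def)
    also have "\<dots> \<le> b ^ n * \<bar>x ^ n - z ^ n\<bar>"
      using staircase_lipschitz[of "b ^ n" "x ^ n - y n" "z ^ n - y n"] b by simp
    also have "\<dots> \<le> b ^ n * (real n * c ^ (n - 1) * \<bar>x - z\<bar>)"
      using b by (intro mult_left_mono power_diff_bounds(2)[OF a0(1) xz n]) auto
    finally have "a ^ (n - 1) * \<bar>\<phi> n x - \<phi> n z\<bar> \<le> b ^ n * c ^ (n - 1) * \<bar>x - z\<bar>"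
      using n by (simp add: mult_ac mult_le_cancel_left_pos)
    hence "\<bar>\<phi> n x - \<phi> n z\<bar> \<le> b ^ n * (c / a) ^ (n - 1) * \<bar>x - z\<bar>"
      using a0 by (simp add: field_simps power_divide)
    also have "\<dots> \<le> b ^ n * (c / a) ^ n * \<bar>x - z\<bar>"
      using a b by (intro mult_right_mono mult_left_mono power_increasing) auto
    finally show ?thesis by (simp add: power_mult_distrib power_divide)
  qed
  show ?thesis
  proof
    show "a < c" "0 < s" "s < 1" by fact+
  next
    fix n x assume "0 < (n::nat)" "x \<in> {a..c}"
    thus "\<phi> n x \<in> {a..c}" unfolding \<phi>_def by (intro clamped_root_range(1) a0)
  next
    fix n x z assume n: "0 < (n::nat)" and xz: "x \<in> {a..c}" "z \<in> {a..c}"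
    define r where "r = \<bar>x - z\<bar>"
    define g where "g = a * (1/a) ^ n"
    define K where "K = (b * c / a) ^ n"
    have K: "0 \<le> K" using b a by (simp add: K_def)
    have le: "\<bar>\<phi> n x - \<phi> n z\<bar> \<le> r + 2 * g"
      using near[OF n xz(1)] near[OF n xz(2)] unfolding r_def g_def by linarith
    have "\<bar>\<phi> n x - \<phi> n z\<bar> \<le> 3 * r + (3 * g) powr (1 - s) * K powr s * r powr s"
    \<comment> \<open>For r at least g, the displacement bound r + 2 g is at most 3 r. Otherwise it
      is at most 3 g and is interpolated with the Lipschitz bound K r.\<close>
    proof (cases "g \<le> r")
      case True
      thus ?thesis using le by (intro add_increasing2) auto
    next
      case False
      have "\<bar>\<phi> n x - \<phi> n z\<bar> \<le> (3 * g) powr (1 - s) * (K * r) powr s"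
        using le False lip[OF n xz] s by (intro powr_interpolate) (auto simp: r_def K_def)
      also have "\<dots> = (3 * g) powr (1 - s) * K powr s * r powr s"
        using K by (simp add: powr_mult r_def mult.assoc)
      also have "\<dots> \<le> 3 * r + (3 * g) powr (1 - s) * K powr s * r powr s" by (simp add: r_def)
      finally show ?thesis .
    qed
    thus "\<bar>\<phi> n x - \<phi> n z\<bar> \<le> 3 * \<bar>x - z\<bar> +
        (3 * (a * (1/a) ^ n)) powr (1 - s) * ((b * c / a) ^ n) powr s * \<bar>x - z\<bar> powr s"
      by (simp add: r_def g_def K_def)
  next
    have "(\<lambda>n. a * (1/a) ^ n) \<longlonglongrightarrow> a * 0"
      using a by (intro tendsto_intros LIMSEQ_power_zero) auto
    thus "(\<lambda>n. a * (1/a) ^ n) \<longlonglongrightarrow> 0" by simp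
  next
    \<comment> \<open>The ratio of the geometric sequence \<open>\<kappa>\<close>. The powers of a
      combine to w = (b c)^s / a, and \<open>small\<close> is exactly w < 1.\<close>
    define w where "w = (1/a) powr (1 - s) * (b * c / a) powr s"
    have "w = (b * c) powr s / a"
      using a b by (simp add: w_def powr_divide powr_diff)
    hence w: "0 \<le> w" "w < 1" using small a by auto
    have "(3 * (a * (1/a) ^ n)) powr (1 - s) * ((b * c / a) ^ n) powr s = (3 * a) powr (1 - s) * w ^ n" for n
    proof -
      have "(3 * (a * (1/a) ^ n)) powr (1 - s) = (3 * a) powr (1 - s) * ((1/a) ^ n) powr (1 - s)"
        using a0 by (simp add: powr_mult[symmetric] mult.assoc)
      thus ?thesis using a b
        by (simp only: power_powr[of "1/a"] power_powr[of "b * c / a"] w_def power_mult_distrib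
            mult.assoc zero_less_divide_iff) (simp add: power_powr)
    qed
    moreover have "(\<lambda>n. (3 * a) powr (1 - s) * w ^ n) \<longlonglongrightarrow> (3 * a) powr (1 - s) * 0"
      using w by (intro tendsto_intros LIMSEQ_power_zero) auto
    ultimately show "(\<lambda>n. (3 * (a * (1/a) ^ n)) powr (1 - s) * ((b * c / a) ^ n) powr s) \<longlonglongrightarrow> 0"
      by simp
  next
    fix n x z assume n: "0 < (n::nat)" and z: "z \<in> {a..c}"
      and x: "x \<in> {a..c} - {x. nearest_int_dist (x ^ n - y n) < 1 / b ^ n}"
      and xz: "\<bar>z - x\<bar> \<le> 1 / b ^ n / (2 * real n * c ^ (n - 1))"
    define u where "u = z ^ n - y n"
    \<comment> \<open>The margin lets z^n differ from x^n by at most half of b^(-n). So z^n - y_n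
      keeps the other half as distance from all integers, the threshold of
      \<open>staircase_flat\<close> at slope b^n.\<close>
    have "\<bar>z ^ n - x ^ n\<bar> \<le> real n * c ^ (n - 1) * \<bar>z - x\<bar>"
      using x by (intro power_diff_bounds(2)[OF a0(1) z _ n]) auto
    also have "\<dots> \<le> real n * c ^ (n - 1) * (1 / b ^ n / (2 * real n * c ^ (n - 1)))"
      using xz a by (intro mult_left_mono) auto
    also have "\<dots> = 1 / (2 * b ^ n)" using n a b by (simp add: field_simps)
    finally have zx: "\<bar>z ^ n - x ^ n\<bar> \<le> 1 / (2 * b ^ n)" .
    have "1 / (2 * b ^ n) \<le> \<bar>u - of_int m\<bar>" for m
    proof -
      have "1 / b ^ n \<le> \<bar>x ^ n - y n - of_int m\<bar>"
        using x nearest_int_dist_le[of "x ^ n - y n" m] by auto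
      moreover have "1 / b ^ n = 1 / (2 * b ^ n) + 1 / (2 * b ^ n)" by simp
      ultimately show ?thesis using zx unfolding u_def by linarith
    qed
    then obtain m where m: "m \<in> {floor u - 2..floor u + 2}" "staircase (b ^ n) u = of_int m + 1/2"
      using staircase_flat[of "b ^ n" u] b by (auto simp: algebra_simps)
    have "a ^ n \<le> z ^ n" "z ^ n \<le> c ^ n" using z a0 by (auto intro!: power_mono)
    hence "floor (a ^ n - y n) \<le> floor u" "floor u \<le> floor (c ^ n - y n)"
      unfolding u_def by (auto intro!: floor_mono)
    hence "m \<in> {floor (a ^ n - y n) - 2..floor (c ^ n - y n) + 2}" using m(1) by auto
    moreover have "\<phi> n z = clamped_root a c n (y n + (of_int m + 1/2))"
      unfolding \<phi>_def u_def[symmetric] m(2) ..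
    ultimately show "\<phi> n z \<in> (\<lambda>m. clamped_root a c n (y n + (of_int m + 1/2))) `
        {floor (a ^ n - y n) - 2..floor (c ^ n - y n) + 2}" by (rule rev_image_eqI)
  qed (use near lip a b in auto)
qed

section \<open>The two dimension bounds and the limit\<close>

lemma hausdorff_dim_E_set_ge:
  assumes b: "1 < b" and v: "1 < v" "v < c" and s: "0 < s" "s < 1" and small: "(b * c) powr s < v"
  shows "ennreal s \<le> hausdorff_dim ({v..c} \<inter> E_set b y)"
proof -
  define S where "S = {x \<in> {v..c}. infinite {n. n > 0 \<and> x \<in> {x. nearest_int_dist (x ^ n - y n) < 1 / b ^ n}}}"
  have "ennreal s \<le> hausdorff_dim S"
  proof (rule collapsing_maps.holder_image_limsup[OF snap_collapsing_maps[OF b v s small, of y]])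
    fix f :: "real \<Rightarrow> real" and C p q Z
    assume f: "0 < C" "p < q" "countable Z"
        "\<And>x z. x \<in> {v..c} \<Longrightarrow> z \<in> {v..c} \<Longrightarrow> \<bar>f x - f z\<bar> \<le> C * \<bar>x - z\<bar> powr s"
        "{p..q} - Z \<subseteq> f ` {x \<in> {v..c}. infinite {n. n > 0 \<and> x \<in> {x. nearest_int_dist (x ^ n - y n) < 1 / b ^ n}}}"
    show ?thesis
    proof (rule hausdorff_dim_ge_holder_image[OF s(1) f(1-3)])
      show "{p..q} - Z \<subseteq> f ` S" using f(5) unfolding S_def .
    qed (use f(4) in \<open>auto simp: S_def dist_real_def\<close>)
  qed
  also have "\<dots> \<le> hausdorff_dim ({v..c} \<inter> E_set b y)"
    using v by (intro hausdorff_dim_mono) (auto simp: S_def E_set_def Suc_le_eq)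
  finally show ?thesis .
qed

text \<open>At level n about c^n integers k can occur, each with a set of diameter at most 2 a (b
  a)^(-n). The s-sums are therefore dominated by powers of q = c (b a)^(-s), and
  \<open>large\<close> says q < 1.\<close>

lemma hausdorff_dim_E_set_le:
  assumes b: "1 < b" and y: "\<And>n. n \<ge> 1 \<Longrightarrow> y n \<in> {0..1}" and a: "1 < a" "a \<le> c"
    and s: "0 < s" and large: "c < (b * a) powr s"
  shows "hausdorff_dim ({a..c} \<inter> E_set b y) \<le> ennreal s"
proof (rule hausdorff_dim_le)
  define I where "I n = {0..\<lfloor>c ^ n\<rfloor> + 1}" for n
  define U where "U n k = {x \<in> {a..c}. n > 0 \<and> \<bar>x ^ n - y n - of_int k\<bar> < 1 / b ^ n}" for n and k :: int
  define d where "d n = 2 * a * (1 / (b * a)) ^ n" for n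
  define q where "q = c * (1 / (b * a)) powr s"
  show "hausdorff_measure s ({a..c} \<inter> E_set b y) = 0"
  proof (rule hausdorff_measure_limsup_eq_0[of s "3 * (2 * a) powr s" q I _ U d])
    show "0 < s" "0 \<le> 3 * (2 * a) powr s" "0 \<le> q" using s a b by (auto simp: q_def)
    have "q = c / (b * a) powr s" using a b by (simp add: q_def powr_divide)
    thus "q < 1" using large a b by simp
    show "finite (I n)" for n by (simp add: I_def)
    show "bounded (U n k)" for n k
      by (rule bounded_subset[OF bounded_closed_interval[of a c]]) (auto simp: U_def)
  next
    have "1 < b * a" using mult_strict_mono[of 1 b 1 a] a b by simp
    hence "(\<lambda>n. 2 * a * (1 / (b * a)) ^ n) \<longlonglongrightarrow> 2 * a * 0"
      by (intro tendsto_intros LIMSEQ_power_zero) auto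
    thus "d \<longlonglongrightarrow> 0" by (simp add: d_def[abs_def])
  next
    fix x assume x: "x \<in> {a..c} \<inter> E_set b y"
    have "{n. n \<ge> 1 \<and> nearest_int_dist (x ^ n - y n) < 1 / b ^ n} \<subseteq> {n. \<exists>k\<in>I n. x \<in> U n k}"
    proof safe
      fix n :: nat assume n: "1 \<le> n" and "nearest_int_dist (x ^ n - y n) < 1 / b ^ n"
      then obtain z where "z \<in> \<int>" "dist (x ^ n - y n) z < 1 / b ^ n"
        unfolding nearest_int_dist_def by (rule_tac infdist_less_obtains[rotated]) auto
      then obtain k where k: "\<bar>x ^ n - y n - of_int k\<bar> < 1 / b ^ n"
        by (auto simp: dist_real_def elim!: Ints_cases)
      \<comment> \<open>With y_n in [0, 1] and x^n in [1, c^n], an error below 1 forces -1 < k < c^n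
        + 1, which is the range \<open>I n\<close>.\<close>
      have "1 / b ^ n \<le> 1" using b by simp
      moreover have "1 \<le> x ^ n" "x ^ n \<le> c ^ n" using x a by (auto intro: one_le_power power_mono)
      ultimately have "- 1 < real_of_int k" "real_of_int k < c ^ n + 1"
        using k y[OF n] by auto
      hence "k \<in> I n" unfolding I_def by (simp; linarith)
      thus "\<exists>k\<in>I n. x \<in> U n k" using k x n by (auto simp: U_def)
    qed
    moreover have "infinite {n. n \<ge> 1 \<and> nearest_int_dist (x ^ n - y n) < 1 / b ^ n}"
      using x by (simp add: E_set_def)
    ultimately show "infinite {n. \<exists>k\<in>I n. x \<in> U n k}" using finite_subset by blast
  next
    fix n k
    have d0: "0 \<le> d n" using a b by (simp add: d_def)
    show "diameter (U n k) \<le> d n"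
    proof (rule diameter_le)
      fix x z assume xz: "x \<in> U n k" "z \<in> U n k"
      hence n: "0 < n" and xz': "x \<in> {a..c}" "z \<in> {a..c}" by (auto simp: U_def)
      have "1 * a ^ (n - 1) * \<bar>x - z\<bar> \<le> real n * a ^ (n - 1) * \<bar>x - z\<bar>"
        using n a by (intro mult_right_mono) auto
      also have "\<dots> \<le> \<bar>x ^ n - z ^ n\<bar>" using a by (intro power_diff_bounds(1)[OF _ xz' n]) auto
      also have "\<dots> \<le> 2 * (1 / b ^ n)" using xz unfolding U_def by (simp; linarith)
      finally have "a ^ (n - 1) * \<bar>x - z\<bar> \<le> 2 * (1 / b ^ n)" by simp
      hence "a * (a ^ (n - 1) * \<bar>x - z\<bar>) \<le> a * (2 * (1 / b ^ n))"
        using a by (intro mult_left_mono) auto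
      moreover have "a ^ n = a * a ^ (n - 1)" using n by (cases n) auto
      ultimately have "a ^ n * \<bar>x - z\<bar> \<le> 2 * a * (1 / b ^ n)" by (simp add: mult_ac)
      thus "norm (x - z) \<le> d n"
        using a b by (simp add: d_def field_simps power_mult_distrib power_divide)
    qed (use d0 in simp)
  next
    fix n
    \<comment> \<open>This absorbs the additive 2 in the number of integers into the factor
      3.\<close>
    have "1 \<le> c ^ n" using a by (intro one_le_power) auto
    moreover have "0 \<le> \<lfloor>c ^ n\<rfloor>" using \<open>1 \<le> c ^ n\<close> by simp
    hence "real (card (I n)) = of_int \<lfloor>c ^ n\<rfloor> + 2" unfolding I_def by simp
    ultimately have "real (card (I n)) \<le> 3 * c ^ n" using of_int_floor_le[of "c ^ n"] by linarith
    moreover have "d n powr s = (2 * a) powr s * ((1 / (b * a)) powr s) ^ n"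
      using a b by (simp add: d_def powr_mult power_powr)
    ultimately have "real (card (I n)) * d n powr s
        \<le> 3 * c ^ n * ((2 * a) powr s * ((1 / (b * a)) powr s) ^ n)"
      by (simp only:) (intro mult_right_mono, auto)
    also have "\<dots> = 3 * (2 * a) powr s * q ^ n" by (simp add: q_def power_mult_distrib)
    finally show "real (card (I n)) * d n powr s \<le> 3 * (2 * a) powr s * q ^ n" .
  qed
qed (use s in simp)

theorem theorem1p1:
  fixes b v :: real and y :: "nat \<Rightarrow> real"
  assumes "b > 1"
    and "\<And>n. n \<ge> 1 \<Longrightarrow> y n \<in> {0..1}"
    and "v > 1"
  shows "((\<lambda>\<epsilon>. hausdorff_dim ({v - \<epsilon>..v + \<epsilon>} \<inter> E_set b y)) \<longlongrightarrow> ennreal (ln v / ln (b * v)))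
           (at_right 0)"
proof -
  define T where "T = ln v / ln (b * v)"
  have lns: "0 < ln v" "ln v < ln (b * v)" using assms by simp_all
  hence T: "0 < T" "T < 1" by (simp_all add: T_def)
  have bv: "0 < b * v" using assms by simp
  \<comment> \<open>T is the exponent with (b v)^T = v, so comparing s with T amounts to the
    hypotheses of the two bounds at a = c = v.\<close>
  have powr_compare: "s < T \<longleftrightarrow> (b * v) powr s < v" "T < s \<longleftrightarrow> v < (b * v) powr s" for s
  proof -
    have "s < T \<longleftrightarrow> s * ln (b * v) < ln v" "T < s \<longleftrightarrow> ln v < s * ln (b * v)"
      using lns by (simp_all add: T_def field_simps)
    moreover have "ln ((b * v) powr s) = s * ln (b * v)" using bv by (simp add: ln_powr)
    ultimately show "s < T \<longleftrightarrow> (b * v) powr s < v" "T < s \<longleftrightarrow> v < (b * v) powr s"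
      using ln_less_cancel_iff[of "(b * v) powr s" v] ln_less_cancel_iff[of v "(b * v) powr s"] bv assms(1,3)
      by auto
  qed
  have "((\<lambda>\<epsilon>. hausdorff_dim ({v - \<epsilon>..v + \<epsilon>} \<inter> E_set b y)) \<longlongrightarrow> ennreal T) (at_right 0)"
  proof (rule order_tendstoI)
    fix l assume "l < ennreal T"
    \<comment> \<open>The intermediate z is needed because l is an extended real and may be 0; it
      supplies a real s with 0 < s < T.\<close>
    then obtain z where z: "l < z" "z < ennreal T" using dense by blast
    define s where "s = enn2real z"
    have "z < top" using z(2) ennreal_less_top by (rule less_trans)
    hence zs: "z = ennreal s" by (simp add: s_def)
    have "0 < z" using z(1) by (rule le_less_trans[rotated]) simp
    hence s: "0 < s" "s < T" using z(2) T by (auto simp: zs ennreal_less_iff)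
    \<comment> \<open>The strict inequality at v persists for c = v + \<epsilon> by continuity. The
      right half of the interval is enough for the lower bound.\<close>
    have "((\<lambda>\<epsilon>. (b * (v + \<epsilon>)) powr s) \<longlongrightarrow> (b * (v + 0)) powr s) (at_right 0)"
      using bv by (intro tendsto_intros) auto
    hence "\<forall>\<^sub>F \<epsilon> in at_right 0. (b * (v + \<epsilon>)) powr s < v"
      using s(2) powr_compare(1) by (intro order_tendstoD(2)) auto
    thus "\<forall>\<^sub>F \<epsilon> in at_right 0. l < hausdorff_dim ({v - \<epsilon>..v + \<epsilon>} \<inter> E_set b y)"
      using eventually_at_right_less[of 0]
    proof eventually_elim
      case (elim \<epsilon>)
      have "ennreal s \<le> hausdorff_dim ({v..v + \<epsilon>} \<inter> E_set b y)"
        using elim s T assms by (intro hausdorff_dim_E_set_ge) auto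
      also have "\<dots> \<le> hausdorff_dim ({v - \<epsilon>..v + \<epsilon>} \<inter> E_set b y)"
        using elim(2) by (intro hausdorff_dim_mono) auto
      finally show ?case using z(1) zs by simp
    qed
  next
    fix u assume "ennreal T < u"
    then obtain z where z: "ennreal T < z" "z < u" using dense by blast
    define s where "s = enn2real z"
    have "z < top" using z(2) top_greatest by (rule less_le_trans)
    hence zs: "z = ennreal s" by (simp add: s_def)
    have s: "T < s" using z(1) T by (simp add: zs ennreal_less_iff)
    \<comment> \<open>For the upper bound both ends move, a = v - \<epsilon> and c = v + \<epsilon>,
      so the difference of the two sides is followed to its positive limit.\<close>
    have "((\<lambda>\<epsilon>. (b * (v - \<epsilon>)) powr s - (v + \<epsilon>)) \<longlongrightarrow> (b * (v - 0)) powr s - (v + 0)) (at_right 0)"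
      using bv by (intro tendsto_intros) auto
    moreover have "0 < (b * (v - 0)) powr s - (v + 0)" using s powr_compare(2)[of s] by simp
    ultimately have "\<forall>\<^sub>F \<epsilon> in at_right 0. 0 < (b * (v - \<epsilon>)) powr s - (v + \<epsilon>)"
      by (rule order_tendstoD(1))
    moreover have "((\<lambda>\<epsilon>. v - \<epsilon>) \<longlongrightarrow> v - 0) (at_right 0)" by (intro tendsto_intros)
    hence "\<forall>\<^sub>F \<epsilon> in at_right 0. 1 < v - \<epsilon>" by (rule order_tendstoD(1)) (use assms(3) in simp)
    ultimately show "\<forall>\<^sub>F \<epsilon> in at_right 0. hausdorff_dim ({v - \<epsilon>..v + \<epsilon>} \<inter> E_set b y) < u"
      using eventually_at_right_less[of 0]
    proof eventually_elim
      case (elim \<epsilon>)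
      have "hausdorff_dim ({v - \<epsilon>..v + \<epsilon>} \<inter> E_set b y) \<le> ennreal s"
        using elim s T assms(1) by (intro hausdorff_dim_E_set_le assms(2)) auto
      thus ?case using z(2) zs by simp
    qed
  qed
  thus ?thesis by (simp add: T_def)
qed

end
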